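(* Let $p$ be a probability density with support $\mathbb{R}$ that is even, i.e. $p(-x)=p(x)$ for all $x\in\mathbb{R}$, and let $\mathcal{L}=\{p_l : l\in\mathbb{R}\}$ with $p_l(x)=p(x-l)$ be the associated location family. Then all $f$-divergences between densities of $\mathcal{L}$ are symmetric: for every convex function $f$ on $(0,\infty)$, strictly convex at $1$, with $f(1)=0$, and all $l_1,l_2\in\mathbb{R}$, $$I_f(p_{l_1}:p_{l_2})=I_f(p_{l_2}:p_{l_1}).$$
   Context: Densities are probability densities with respect to Lebesgue measure on $\mathbb{R}$; having support $\mathbb{R}$ means being positive on $\mathbb{R}$. For two densities $p,q$ with support $\mathcal{X}$ (here $\mathcal{X}=\mathbb{R}$), the $f$-divergence is $I_f(p:q)=\int_{\mathcal{X}}p(x)\,f\left(\frac{q(x)}{p(x)}\right)dx\in[0,+\infty]$. *)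

theory Defs
  imports "HOL-Analysis.Analysis"
begin

definition prob_density :: "(real \<Rightarrow> real) \<Rightarrow> bool" where
  "prob_density p \<longleftrightarrow>
     p \<in> borel_measurable lebesgue \<and> (\<forall>x. 0 \<le> p x) \<and> (\<integral>\<^sup>+x. ennreal (p x) \<partial>lebesgue) = 1"

definition full_support :: "(real \<Rightarrow> real) \<Rightarrow> bool" where
  "full_support p \<longleftrightarrow> (\<forall>x. 0 < p x)"

definition strictly_convex_at :: "real set \<Rightarrow> (real \<Rightarrow> real) \<Rightarrow> real \<Rightarrow> bool" where
  "strictly_convex_at S f c \<longleftrightarrow>
     (\<forall>x\<in>S. \<forall>y\<in>S. \<forall>t. x \<noteq> y \<and> 0 < t \<and> t < 1 \<and> (1 - t) * x + t * y = c
        \<longrightarrow> f c < (1 - t) * f x + t * f y)"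

definition location_density :: "(real \<Rightarrow> real) \<Rightarrow> real \<Rightarrow> real \<Rightarrow> real" where
  "location_density p l = (\<lambda>x. p (x - l))"

text \<open>
  The integral \<open>\<integral> p (f \<circ> (q / p))\<close> may be \<open>\<infinity>\<close> and its integrand may change sign, so it is the
  difference of the integrals of the positive and negative parts (\<^const>\<open>ennreal\<close> maps negative
  reals to \<open>0\<close>). For convex \<open>f\<close> with \<open>f 1 = 0\<close> the subtracted integral is finite, so the
  case \<open>\<infinity> - \<infinity>\<close> does not arise; this is lemma \<open>f_divergence_negative_part_finite\<close>.
\<close>

definition f_divergence :: "(real \<Rightarrow> real) \<Rightarrow> (real \<Rightarrow> real) \<Rightarrow> (real \<Rightarrow> real) \<Rightarrow> ereal" where
  "f_divergence f p q =
     enn2ereal (\<integral>\<^sup>+x. ennreal (p x * f (q x / p x)) \<partial>lebesgue)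
     - enn2ereal (\<integral>\<^sup>+x. ennreal (- (p x * f (q x / p x))) \<partial>lebesgue)"

lemma f_divergence_negative_part_finite:
  assumes p: "prob_density p" "full_support p" and q: "prob_density q" "full_support q"
    and f: "convex_on {0<..} f" "f 1 = 0"
  shows "(\<integral>\<^sup>+x. ennreal (- (p x * f (q x / p x))) \<partial>lebesgue) < \<infinity>"
proof -
  define c where "c = Inf ((\<lambda>t. (f 1 - f t) / (1 - t)) ` ({1<..} \<inter> {0<..}))"
  have c: "c * (u - 1) \<le> f u" if "0 < u" for u
    using convex_le_Inf_differential[OF f(1), of 1 u] f(2) that
    unfolding c_def by (simp add: interior_open)
  have bound: "- (p x * f (q x / p x)) \<le> \<bar>c\<bar> * (p x + q x)" for x
  proof -
    have px: "0 < p x" and qx: "0 < q x"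
      using p(2) q(2) by (auto simp: full_support_def)
    have "p x * (c * (q x / p x - 1)) \<le> p x * f (q x / p x)"
      using c[of "q x / p x"] px qx by (intro mult_left_mono) auto
    moreover have "p x * (c * (q x / p x - 1)) = c * (q x - p x)"
      using px by (simp add: field_simps)
    moreover have "- (c * (q x - p x)) \<le> \<bar>c\<bar> * \<bar>q x - p x\<bar>"
      by (metis abs_ge_minus_self abs_mult)
    moreover have "\<bar>c\<bar> * \<bar>q x - p x\<bar> \<le> \<bar>c\<bar> * (p x + q x)"
      using px qx by (intro mult_left_mono) auto
    ultimately show ?thesis by linarith
  qed
  have "(\<integral>\<^sup>+x. ennreal (- (p x * f (q x / p x))) \<partial>lebesgue)
        \<le> (\<integral>\<^sup>+x. ennreal \<bar>c\<bar> * (ennreal (p x) + ennreal (q x)) \<partial>lebesgue)"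
    using p q bound
    by (intro nn_integral_mono)
       (auto simp: prob_density_def ennreal_plus[symmetric] ennreal_mult[symmetric]
             simp del: ennreal_plus intro!: ennreal_leI)
  also have "\<dots> = ennreal \<bar>c\<bar> * (1 + 1)"
  proof -
    have [measurable]: "p \<in> borel_measurable lebesgue" "q \<in> borel_measurable lebesgue"
      using p(1) q(1) by (auto simp: prob_density_def)
    have "(\<integral>\<^sup>+x. ennreal (p x) + ennreal (q x) \<partial>lebesgue) = 1 + 1"
      using p(1) q(1) by (subst nn_integral_add) (auto simp: prob_density_def)
    then show ?thesis
      by (subst nn_integral_cmult) auto
  qed
  also have "\<dots> < \<infinity>"
    by (simp add: ennreal_mult_less_top)
  finally show ?thesis .
qed

end

theory Submission
  imports Defs
begin

text \<open>
  The reflection \<open>x \<mapsto> l1 + l2 - x\<close> about the midpoint of the two locations preserves Lebesgue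
  measure. Because \<open>p\<close> is even, it exchanges the two densities: it sends \<open>x - l1\<close> to
  \<open>- (x - l2)\<close> and \<open>x - l2\<close> to \<open>- (x - l1)\<close>. Substituting it in the integral that defines one
  divergence therefore produces the integral that defines the other. The substitution,
  \<open>nn_integral_lebesgue_reflect\<close>, is valid for every nonnegative integrand, so it applies to
  the integrals of the positive and of the negative part separately.
\<close>

lemma lebesgue_eq_distr_reflect:
  "lebesgue = distr lebesgue lebesgue (\<lambda>x. c - x :: real)"
  using lebesgue_affine_euclidean[of "\<lambda>_. - 1" c]
  by (simp add: density_1)

lemma measurable_reflect_lebesgue:
  "(\<lambda>x. c - x :: real) \<in> lebesgue \<rightarrow>\<^sub>M lebesgue"
  using lebesgue_affine_measurable[of "\<lambda>_. - 1" c]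
  by simp

text \<open>
  The integral of an arbitrary integrand is the supremum over the simple functions below it. These
  are measurable, so each of them can be reflected by the image measure formula. This gives one
  inequality, and the other one follows because a reflection is its own inverse.
\<close>

lemma nn_integral_lebesgue_reflect:
  fixes g :: "real \<Rightarrow> ennreal" and c :: real
  shows "(\<integral>\<^sup>+x. g (c - x) \<partial>lebesgue) = (\<integral>\<^sup>+x. g x \<partial>lebesgue)"
proof -
  have le: "(\<integral>\<^sup>+x. h x \<partial>lebesgue) \<le> (\<integral>\<^sup>+x. h (c - x) \<partial>lebesgue)" for h :: "real \<Rightarrow> ennreal"
  proof -
    have "integral\<^sup>S lebesgue s \<le> (\<integral>\<^sup>+x. h (c - x) \<partial>lebesgue)"
      if s: "simple_function lebesgue s" "s \<le> h" for s
    proof -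
      have meas: "s \<in> borel_measurable lebesgue"
        using s(1) by (rule borel_measurable_simple_function)
      have "integral\<^sup>S lebesgue s = (\<integral>\<^sup>+x. s x \<partial>lebesgue)"
        using s(1) by (simp add: nn_integral_eq_simple_integral)
      also have "\<dots> = (\<integral>\<^sup>+x. s x \<partial>distr lebesgue lebesgue (\<lambda>x. c - x))"
        using lebesgue_eq_distr_reflect[of c] by simp
      also have "\<dots> = (\<integral>\<^sup>+x. s (c - x) \<partial>lebesgue)"
        by (rule nn_integral_distr[OF measurable_reflect_lebesgue]) (simp add: meas)
      also have "\<dots> \<le> (\<integral>\<^sup>+x. h (c - x) \<partial>lebesgue)"
        using s(2) by (intro nn_integral_mono) (simp add: le_fun_def)
      finally show ?thesis .
    qed
    then show ?thesis
      unfolding nn_integral_def[of lebesgue h] by (intro SUP_least) auto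
  qed
  show ?thesis
    using le[of g] le[of "\<lambda>x. g (c - x)"] by simp
qed

lemma location_density_reflect:
  assumes "\<forall>x. p (- x) = p x"
  shows "location_density p a (a + b - x) = location_density p b x"
  using assms[rule_format, of "x - b"] by (simp add: location_density_def)

theorem theorem3:
  fixes p f :: "real \<Rightarrow> real" and l1 l2 :: real
  assumes "prob_density p" and "full_support p"
    and "\<forall>x. p (- x) = p x"
    and "convex_on {0<..} f" and "strictly_convex_at {0<..} f 1" and "f 1 = 0"
  shows "f_divergence f (location_density p l1) (location_density p l2)
       = f_divergence f (location_density p l2) (location_density p l1)"
proof -
  have swap: "location_density p l1 (l1 + l2 - x) = location_density p l2 x"
    "location_density p l2 (l1 + l2 - x) = location_density p l1 x" for x
    using location_density_reflect[OF assms(3), of l1 l2 x]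
      location_density_reflect[OF assms(3), of l2 l1 x]
    by (simp_all add: add.commute)
  let ?d = "\<lambda>x. location_density p l1 x * f (location_density p l2 x / location_density p l1 x)"
  show ?thesis
    using nn_integral_lebesgue_reflect[of "\<lambda>x. ennreal (?d x)" "l1 + l2"]
      nn_integral_lebesgue_reflect[of "\<lambda>x. ennreal (- ?d x)" "l1 + l2"]
    by (simp add: f_divergence_def swap)
qed

end
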